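(* Let $X$ be a bounded geometry metric space. If $X$ has the operator norm localisation property, then $X$ has property $ULA$.
   Context: A metric space $X$ has bounded geometry if for all $R>0$ there is $N_R\in\mathbb{N}$ such that every closed ball of radius $R$ in $X$ has at most $N_R$ points (so $X$ is countable). For $E\subseteq X$ and $R>0$: $N_R(E)=\{y\in X: d(y,E)\le R\}$ and $\partial_RE=N_R(E)\setminus E$. $ULA$: for all $R,\epsilon>0$ there exists $S>0$ such that for all finite nonempty subsets $F$ of $X$ there exists a finite set $E\subseteq X$ with $\mathrm{diam}(E)\le S$ and $|\partial_RE\cap F|<\epsilon|E\cap F|$. Operator norm localisation property (ONL): for a probability measure $\mu$ on $X$ and a nonzero separable Hilbert space $\mathcal{H}$, let $l^2(X,\mu,\mathcal{H})$ be the Hilbert space of functions $\phi:X\to\mathcal{H}$ with $\|\phi\|^2=\sum_{x\in X}\mu(x)\|\phi(x)\|_{\mathcal{H}}^2<\infty$, modulo functions of norm zero; the support of (the class of) $\phi$ is $\{x:\mu(x)>0,\ \phi(x)\neq 0\}$. A bounded operator $T$ on it is regarded as a matrix $(T_{x,y})$ of bounded operators on $\mathcal{H}$ (indexed by points of the support of $\mu$). For $R>0$, $\mathbb{C}_R[X;\mu,\mathcal{H}]$ is the set of bounded operators $T$ with $T_{x,y}=0$ whenever $d(x,y)>R$. $X$ has ONL if there exists $c>0$ such that for every $R>0$ there exists $S>0$ such that for every probability measure $\mu$ on $X$, every nonzero separable Hilbert space $\mathcal{H}$ and every $T\in\mathbb{C}_R[X;\mu,\mathcal{H}]$ there is a unit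 vector $\phi\in l^2(X,\mu,\mathcal{H})$ with $\mathrm{diam}(\mathrm{supp}(\phi))\le S$ and $\|T\phi\|\ge c\|T\|$. *)

theory Defs
  imports "HOL-Probability.Probability"
begin

section \<open>Bounded geometry and uniform local amenability\<close>

definition bounded_geometry :: "'a::metric_space itself \<Rightarrow> bool" where
  "bounded_geometry _ \<longleftrightarrow>
    (\<forall>R>0. \<exists>N::nat. \<forall>x::'a. finite (cball x R) \<and> card (cball x R) \<le> N)"

text \<open>The library sets \<open>infdist y {} = 0\<close>; here \<open>d(y, {}) = \<infinity>\<close>, hence the guard.\<close>

definition nbhd :: "real \<Rightarrow> 'a::metric_space set \<Rightarrow> 'a set" where
  "nbhd R E = {y. E \<noteq> {} \<and> infdist y E \<le> R}"

definition bdry :: "real \<Rightarrow> 'a::metric_space set \<Rightarrow> 'a set" where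
  "bdry R E = nbhd R E - E"

definition ULA :: "'a::metric_space itself \<Rightarrow> bool" where
  "ULA _ \<longleftrightarrow>
    (\<forall>R>0. \<forall>\<epsilon>>0. \<exists>S>0. \<forall>F::'a set. finite F \<and> F \<noteq> {} \<longrightarrow>
      (\<exists>E. finite E \<and> diameter E \<le> S \<and>
           real (card (bdry R E \<inter> F)) < \<epsilon> * real (card (E \<inter> F))))"

section \<open>Complex Hilbert spaces with explicit carriers\<close>

record 'h hilbert =
  hcarrier :: "'h set"
  hzero :: 'h
  hadd :: "'h \<Rightarrow> 'h \<Rightarrow> 'h"
  hscale :: "complex \<Rightarrow> 'h \<Rightarrow> 'h"
  hinner :: "'h \<Rightarrow> 'h \<Rightarrow> complex"

definition hminus :: "'h hilbert \<Rightarrow> 'h \<Rightarrow> 'h \<Rightarrow> 'h" where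
  "hminus H v w = hadd H v (hscale H (-1) w)"

definition hnorm :: "'h hilbert \<Rightarrow> 'h \<Rightarrow> real" where
  "hnorm H v = sqrt (Re (hinner H v v))"

definition hdist :: "'h hilbert \<Rightarrow> 'h \<Rightarrow> 'h \<Rightarrow> real" where
  "hdist H v w = hnorm H (hminus H v w)"

locale complex_hilbert_space =
  fixes H :: "'h hilbert"
  assumes zero_closed: "hzero H \<in> hcarrier H"
    and add_closed: "\<lbrakk>u \<in> hcarrier H; v \<in> hcarrier H\<rbrakk> \<Longrightarrow> hadd H u v \<in> hcarrier H"
    and scale_closed: "v \<in> hcarrier H \<Longrightarrow> hscale H a v \<in> hcarrier H"
    and add_assoc: "\<lbrakk>u \<in> hcarrier H; v \<in> hcarrier H; w \<in> hcarrier H\<rbrakk> \<Longrightarrow>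
      hadd H (hadd H u v) w = hadd H u (hadd H v w)"
    and add_commute: "\<lbrakk>u \<in> hcarrier H; v \<in> hcarrier H\<rbrakk> \<Longrightarrow> hadd H u v = hadd H v u"
    and add_zero: "v \<in> hcarrier H \<Longrightarrow> hadd H v (hzero H) = v"
    and add_inverse: "v \<in> hcarrier H \<Longrightarrow> \<exists>w\<in>hcarrier H. hadd H v w = hzero H"
    and scale_one: "v \<in> hcarrier H \<Longrightarrow> hscale H 1 v = v"
    and scale_scale: "v \<in> hcarrier H \<Longrightarrow> hscale H a (hscale H b v) = hscale H (a * b) v"
    and scale_add_left: "v \<in> hcarrier H \<Longrightarrow>
      hscale H (a + b) v = hadd H (hscale H a v) (hscale H b v)"
    and scale_add_right: "\<lbrakk>u \<in> hcarrier H; v \<in> hcarrier H\<rbrakk> \<Longrightarrow>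
      hscale H a (hadd H u v) = hadd H (hscale H a u) (hscale H a v)"
    and inner_commute: "\<lbrakk>u \<in> hcarrier H; v \<in> hcarrier H\<rbrakk> \<Longrightarrow>
      hinner H v u = cnj (hinner H u v)"
    and inner_add: "\<lbrakk>u \<in> hcarrier H; v \<in> hcarrier H; w \<in> hcarrier H\<rbrakk> \<Longrightarrow>
      hinner H u (hadd H v w) = hinner H u v + hinner H u w"
    and inner_scale: "\<lbrakk>u \<in> hcarrier H; v \<in> hcarrier H\<rbrakk> \<Longrightarrow>
      hinner H u (hscale H a v) = a * hinner H u v"
    and inner_nonneg: "v \<in> hcarrier H \<Longrightarrow> 0 \<le> Re (hinner H v v)"
    and inner_definite: "v \<in> hcarrier H \<Longrightarrow> hinner H v v = 0 \<longleftrightarrow> v = hzero H"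
    and complete: "Metric_space.mcomplete (hcarrier H) (hdist H)"

definition nonzero_separable_hilbert :: "'h hilbert \<Rightarrow> bool" where
  "nonzero_separable_hilbert H \<longleftrightarrow>
    complex_hilbert_space H \<and> (\<exists>v\<in>hcarrier H. v \<noteq> hzero H) \<and>
    separable_space (Metric_space.mtopology (hcarrier H) (hdist H))"

text \<open>Operators are considered on \<open>hcarrier H\<close> only.\<close>

definition bounded_op :: "'h hilbert \<Rightarrow> ('h \<Rightarrow> 'h) \<Rightarrow> bool" where
  "bounded_op H T \<longleftrightarrow>
    (\<forall>v\<in>hcarrier H. T v \<in> hcarrier H) \<and>
    (\<forall>u\<in>hcarrier H. \<forall>v\<in>hcarrier H. T (hadd H u v) = hadd H (T u) (T v)) \<and>
    (\<forall>a. \<forall>v\<in>hcarrier H. T (hscale H a v) = hscale H a (T v)) \<and>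
    (\<exists>K. \<forall>v\<in>hcarrier H. hnorm H (T v) \<le> K * hnorm H v)"

definition op_norm :: "'h hilbert \<Rightarrow> ('h \<Rightarrow> 'h) \<Rightarrow> real" where
  "op_norm H T = (SUP v\<in>{v \<in> hcarrier H. hnorm H v \<le> 1}. hnorm H (T v))"

section \<open>The Hilbert space of square-summable functions\<close>

text \<open>On a countable space the probability measures are exactly the elements of type \<open>pmf\<close>.\<close>

definition l2_fun :: "'a pmf \<Rightarrow> 'h hilbert \<Rightarrow> ('a \<Rightarrow> 'h) set" where
  "l2_fun \<mu> H = {\<phi>. (\<forall>x. \<phi> x \<in> hcarrier H) \<and>
     (\<lambda>x. pmf \<mu> x * (hnorm H (\<phi> x))\<^sup>2) summable_on UNIV}"

definition l2_rel :: "'a pmf \<Rightarrow> 'h hilbert \<Rightarrow> (('a \<Rightarrow> 'h) \<times> ('a \<Rightarrow> 'h)) set" where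
  "l2_rel \<mu> H = {(\<phi>, \<psi>). \<phi> \<in> l2_fun \<mu> H \<and> \<psi> \<in> l2_fun \<mu> H \<and>
     (\<Sum>\<^sub>\<infinity>x. pmf \<mu> x * (hnorm H (hminus H (\<phi> x) (\<psi> x)))\<^sup>2) = 0}"

definition l2_class :: "'a pmf \<Rightarrow> 'h hilbert \<Rightarrow> ('a \<Rightarrow> 'h) \<Rightarrow> ('a \<Rightarrow> 'h) set" where
  "l2_class \<mu> H \<phi> = l2_rel \<mu> H `` {\<phi>}"

text \<open>The quotient space. In \<open>hinner\<close>, the set of values over all pairs of representatives
  is a singleton.\<close>

definition l2 :: "'a pmf \<Rightarrow> 'h hilbert \<Rightarrow> ('a \<Rightarrow> 'h) set hilbert" where
  "l2 \<mu> H = \<lparr>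
     hcarrier = l2_fun \<mu> H // l2_rel \<mu> H,
     hzero = l2_class \<mu> H (\<lambda>_. hzero H),
     hadd = (\<lambda>A B. \<Union>\<phi>\<in>A. \<Union>\<psi>\<in>B. l2_class \<mu> H (\<lambda>x. hadd H (\<phi> x) (\<psi> x))),
     hscale = (\<lambda>a A. \<Union>\<phi>\<in>A. l2_class \<mu> H (\<lambda>x. hscale H a (\<phi> x))),
     hinner = (\<lambda>A B. the_elem (\<Union>\<phi>\<in>A. \<Union>\<psi>\<in>B.
       {\<Sum>\<^sub>\<infinity>x. complex_of_real (pmf \<mu> x) * hinner H (\<phi> x) (\<psi> x)}))\<rparr>"

text \<open>The value of a class at \<open>x\<close>, independent of the representative if \<open>x \<in> set_pmf \<mu>\<close>.\<close>

definition l2_val :: "('a \<Rightarrow> 'h) set \<Rightarrow> 'a \<Rightarrow> 'h" where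
  "l2_val A x = the_elem ((\<lambda>\<phi>. \<phi> x) ` A)"

definition l2_supp :: "'a pmf \<Rightarrow> 'h hilbert \<Rightarrow> ('a \<Rightarrow> 'h) set \<Rightarrow> 'a set" where
  "l2_supp \<mu> H A = {x. pmf \<mu> x > 0 \<and> l2_val A x \<noteq> hzero H}"

text \<open>Matrix coefficients, so that \<open>(T \<phi>) x = (\<Sum>y. T\<^sub>x\<^sub>y (\<phi> y))\<close>; meaningful for
  \<open>x, y \<in> set_pmf \<mu>\<close>.\<close>

definition matrix_entry ::
  "'a pmf \<Rightarrow> 'h hilbert \<Rightarrow> (('a \<Rightarrow> 'h) set \<Rightarrow> ('a \<Rightarrow> 'h) set) \<Rightarrow> 'a \<Rightarrow> 'a \<Rightarrow> 'h \<Rightarrow> 'h" where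
  "matrix_entry \<mu> H T x y v =
     l2_val (T (l2_class \<mu> H (\<lambda>z. if z = y then v else hzero H))) x"

definition finite_prop_ops ::
  "real \<Rightarrow> 'a::metric_space pmf \<Rightarrow> 'h hilbert \<Rightarrow> (('a \<Rightarrow> 'h) set \<Rightarrow> ('a \<Rightarrow> 'h) set) set" where
  "finite_prop_ops R \<mu> H = {T. bounded_op (l2 \<mu> H) T \<and>
     (\<forall>x\<in>set_pmf \<mu>. \<forall>y\<in>set_pmf \<mu>. dist x y > R \<longrightarrow>
        (\<forall>v\<in>hcarrier H. matrix_entry \<mu> H T x y v = hzero H))}"

section \<open>Operator norm localisation\<close>

text \<open>HOL cannot quantify over all types inside a formula. The quantifier below ranges over all
  Hilbert space structures on arbitrary subsets of the type \<^typ>\<open>nat \<Rightarrow> complex\<close>; neither the operations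
  nor the inner product are related to the pointwise ones. This covers every separable Hilbert
  space \<open>K\<close> up to isomorphism: if \<open>q\<close> enumerates a dense subset of \<open>K\<close>, then
  \<open>v \<mapsto> (\<lambda>n. d(v, q n))\<close> is injective and the structure of \<open>K\<close> can be transported along it.

  The conjunct \<open>bounded\<close> is needed since \<open>diameter\<close> is not meaningful on unbounded sets.\<close>

definition ONL :: "'a::metric_space itself \<Rightarrow> bool" where
  "ONL _ \<longleftrightarrow>
    (\<exists>c>0. \<forall>R>0. \<exists>S>0. \<forall>(\<mu> :: 'a pmf) (H :: (nat \<Rightarrow> complex) hilbert) T.
       nonzero_separable_hilbert H \<and> T \<in> finite_prop_ops R \<mu> H \<longrightarrow>
       (\<exists>\<phi>\<in>hcarrier (l2 \<mu> H). hnorm (l2 \<mu> H) \<phi> = 1 \<and>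
          bounded (l2_supp \<mu> H \<phi>) \<and> diameter (l2_supp \<mu> H \<phi>) \<le> S \<and>
          hnorm (l2 \<mu> H) (T \<phi>) \<ge> c * op_norm (l2 \<mu> H) T))"

end

theory Submission
  imports Defs
begin

text \<open>
  If ULA fails for \<open>R, \<epsilon>\<close>, there are finite sets \<open>F\<close> such that, in the graph on \<open>F\<close> joining points
  at distance at most \<open>R\<close>, every subset of small diameter has a large boundary. Let \<open>T = 1 - L / (2 D)\<close>,
  where \<open>L\<close> is the graph Laplacian and \<open>D\<close> bounds the degrees. By a local Cheeger inequality
  \<open>\<parallel>T \<phi>\<parallel>\<^sup>2 \<le> q \<parallel>\<phi>\<parallel>\<^sup>2\<close> for \<open>\<phi>\<close> of small support, with \<open>q < 1\<close> depending only on \<open>\<epsilon>\<close> and \<open>D\<close>.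
  Since \<open>T\<close> enlarges supports by at most \<open>R\<close>, also \<open>\<parallel>T\<^sup>n \<phi>\<parallel>\<^sup>2 \<le> q\<^sup>n \<parallel>\<phi>\<parallel>\<^sup>2\<close>. But \<open>T\<^sup>n\<close> has propagation
  \<open>n R\<close> and fixes the constants, so its norm is at least \<open>1\<close>; as the constant \<open>c\<close> of ONL does not depend on
  the propagation, choosing \<open>n\<close> with \<open>q\<^sup>n < c\<^sup>2\<close> contradicts ONL for the uniform measure on \<open>F\<close> and the
  Hilbert space \<open>\<complex>\<close>.
\<close>

section \<open>Lazy walks on finite graphs\<close>

text \<open>Edges are ordered pairs, both orientations being present. Loops are allowed: they count
  towards the degree but contribute nothing to the Laplacian, the energy or an edge
  boundary.\<close>

locale bounded_degree_graph =
  fixes V :: "'a set" and A :: "('a \<times> 'a) set" and D :: real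
  assumes finite_V: "finite V"
    and A_subset: "A \<subseteq> V \<times> V"
    and sym_A: "sym A"
    and D_pos: "D > 0"
    and degree_le: "x \<in> V \<Longrightarrow> real (card (A `` {x})) \<le> D"
begin

lemma finite_A: "finite A"
  using A_subset finite_V by (meson finite_SigmaI finite_subset)

lemma finite_nbrs: "finite (A `` {x})"
  using finite_A by (rule finite_Image)

lemma nbrs_subset: "A `` {x} \<subseteq> V"
  using A_subset by auto

lemma sum_edges: "(\<Sum>(x, y)\<in>A. f x y) = (\<Sum>x\<in>V. \<Sum>y\<in>A `` {x}. f x y)"
proof -
  have "A = Sigma V (\<lambda>x. A `` {x})"
    using A_subset by auto
  then show ?thesis
    using sum.Sigma[of V "\<lambda>x. A `` {x}" f] finite_V finite_nbrs by simp
qed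

lemma sum_edges_swap: "(\<Sum>(x, y)\<in>A. f x y) = (\<Sum>(x, y)\<in>A. f y x)"
proof -
  have "A = prod.swap ` A"
    using sym_A by (force simp: sym_def image_def)
  then have "(\<Sum>(x, y)\<in>A. f x y) = sum (case_prod f) (prod.swap ` A)"
    by simp
  also have "\<dots> = (\<Sum>(x, y)\<in>A. f y x)"
    by (subst sum.reindex) (auto simp: case_prod_beta)
  finally show ?thesis .
qed

lemma sum_edges_fst_le:
  assumes "\<And>x. x \<in> V \<Longrightarrow> 0 \<le> f x"
  shows "(\<Sum>(x, y)\<in>A. f x) \<le> D * sum f V"
  unfolding sum_edges sum_distrib_left
  using assms degree_le by (intro sum_mono) (simp add: mult_right_mono)

section \<open>Energy estimates for the lazy walk\<close>

definition sqnorm :: "('a \<Rightarrow> complex) \<Rightarrow> real" where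
  "sqnorm g = (\<Sum>x\<in>V. (cmod (g x))\<^sup>2)"

text \<open>Every undirected edge between distinct points is counted twice, whence the factor 1/2 in
  \<open>laplacian_form\<close>.\<close>

definition energy :: "('a \<Rightarrow> complex) \<Rightarrow> real" where
  "energy g = (\<Sum>(x, y)\<in>A. (cmod (g x - g y))\<^sup>2)"

definition laplacian :: "('a \<Rightarrow> complex) \<Rightarrow> 'a \<Rightarrow> complex" where
  "laplacian g x = (\<Sum>y\<in>A `` {x}. g x - g y)"

text \<open>The quadratic form of the Laplacian lies between 0 and 2 D times the squared norm, so
  this normalisation makes the walk a positive contraction.\<close>

definition walk :: "('a \<Rightarrow> complex) \<Rightarrow> 'a \<Rightarrow> complex" where
  "walk g x = g x - laplacian g x / complex_of_real (2 * D)"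

lemma sqnorm_nonneg: "0 \<le> sqnorm g"
  unfolding sqnorm_def by (simp add: sum_nonneg)

lemma energy_nonneg: "0 \<le> energy g"
  unfolding energy_def by (auto intro!: sum_nonneg)

text \<open>Summation by parts: the two orientations of an edge together contribute the squared
  modulus of the difference, and reversing all edges does not change the sum.\<close>

lemma laplacian_form: "(\<Sum>x\<in>V. Re (cnj (g x) * laplacian g x)) = energy g / 2"
proof -
  let ?f = "\<lambda>x y. Re (cnj (g x) * (g x - g y))"
  have "(\<Sum>x\<in>V. Re (cnj (g x) * laplacian g x)) = (\<Sum>(x, y)\<in>A. ?f x y)"
    unfolding sum_edges laplacian_def by (simp only: sum_distrib_left Re_sum)
  moreover have "(\<Sum>(x, y)\<in>A. ?f x y) + (\<Sum>(x, y)\<in>A. ?f y x) = energy g"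
    unfolding energy_def sum.distrib[symmetric] cmod_power2
    by (intro sum.cong) (auto simp: power2_eq_square algebra_simps)
  ultimately show ?thesis
    using sum_edges_swap[of ?f] by simp
qed

text \<open>Cauchy-Schwarz at each vertex, where the sum has at most D terms.\<close>

lemma laplacian_bound: "sqnorm (laplacian g) \<le> D * energy g"
proof -
  have "(cmod (laplacian g x))\<^sup>2 \<le> D * (\<Sum>y\<in>A `` {x}. (cmod (g x - g y))\<^sup>2)" if "x \<in> V" for x
  proof -
    have "(cmod (laplacian g x))\<^sup>2 \<le> (\<Sum>y\<in>A `` {x}. cmod (g x - g y))\<^sup>2"
      unfolding laplacian_def by (intro power_mono norm_sum) simp
    also have "\<dots> \<le> (\<Sum>y\<in>A `` {x}. (cmod (g x - g y))\<^sup>2) * real (card (A `` {x}))"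
      by (rule sum_squared_le_sum_of_squares)
    also have "\<dots> \<le> (\<Sum>y\<in>A `` {x}. (cmod (g x - g y))\<^sup>2) * D"
      using degree_le[OF that] by (intro mult_left_mono sum_nonneg) auto
    finally show ?thesis by (simp add: mult.commute)
  qed
  then show ?thesis
    unfolding sqnorm_def energy_def sum_edges sum_distrib_left by (intro sum_mono) (simp add: sum_distrib_left)
qed

text \<open>When the square is expanded, the cross term gains \<open>energy g / (2 * D)\<close> and
  the quadratic term costs at most half of that.\<close>

lemma sqnorm_walk_le: "sqnorm (walk g) \<le> sqnorm g - energy g / (4 * D)"
proof -
  have "(cmod (walk g x))\<^sup>2 =
      (cmod (g x))\<^sup>2 - Re (cnj (g x) * laplacian g x) / D + (cmod (laplacian g x))\<^sup>2 / (4 * D\<^sup>2)" for x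
    unfolding walk_def using D_pos
    by (simp add: cmod_power2 Re_divide_of_real Im_divide_of_real del: of_real_mult)
       (simp add: field_simps power2_eq_square)
  then have "sqnorm (walk g) = sqnorm g - (energy g / 2) / D + sqnorm (laplacian g) / (4 * D\<^sup>2)"
    unfolding sqnorm_def laplacian_form[symmetric] sum_divide_distrib
    by (simp only: sum.distrib sum_subtractf)
  also have "\<dots> \<le> sqnorm g - (energy g / 2) / D + (D * energy g) / (4 * D\<^sup>2)"
    using laplacian_bound[of g] by (intro add_left_mono divide_right_mono) auto
  also have "\<dots> = sqnorm g - energy g / (4 * D)"
    using D_pos by (simp add: field_simps power2_eq_square)
  finally show ?thesis .
qed

lemma sqnorm_walk_le_sqnorm: "sqnorm (walk g) \<le> sqnorm g"
  using sqnorm_walk_le[of g] energy_nonneg[of g] D_pos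
  by (smt (verit) divide_nonneg_pos)

lemma sqnorm_funpow_walk_le_sqnorm: "sqnorm ((walk ^^ n) g) \<le> sqnorm g"
  by (induction n) (auto intro: order_trans sqnorm_walk_le_sqnorm)

section \<open>A local Cheeger inequality\<close>

text \<open>Peel off the smallest positive value of \<open>h\<close>: a level-set argument without integrals.\<close>

lemma coarea:
  assumes "\<And>x. x \<in> V \<Longrightarrow> 0 \<le> h x"
    and "\<And>B. B \<subseteq> {x \<in> V. h x \<noteq> 0} \<Longrightarrow>
      \<epsilon> * real (card B) \<le> real (card {(x, y) \<in> A. x \<in> B \<and> y \<notin> B})"
  shows "\<epsilon> * sum h V \<le> (\<Sum>(x, y)\<in>A. max (h x - h y) 0)"
  using assms
proof (induction "card {x \<in> V. h x \<noteq> 0}" arbitrary: h rule: less_induct)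
  case less
  define P where "P = {x \<in> V. h x \<noteq> 0}"
  have finP: "finite P" unfolding P_def using finite_V by simp
  show ?case
  proof (cases "P = {}")
    case True
    then have "sum h V = 0" unfolding P_def by (intro sum.neutral) auto
    moreover have "0 \<le> (\<Sum>(x, y)\<in>A. max (h x - h y) 0)" by (auto intro!: sum_nonneg)
    ultimately show ?thesis by simp
  next
    case False
    define m where "m = Min (h ` P)"
    \<comment> \<open>Lowering \<open>h\<close> by its least positive value on its support
      \<open>P\<close> keeps it nonnegative and makes it vanish at the minimiser, so the support
      shrinks strictly.\<close>
    define h' where "h' = (\<lambda>x. h x - m * indicator P x)"
    have m_le: "m \<le> h x" if "x \<in> P" for x
      unfolding m_def using that finP by simp
    obtain p where p: "p \<in> P" "m = h p"
    proof -
      have "m \<in> h ` P" unfolding m_def using finP False by (intro Min_in) auto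
      then show thesis using that by auto
    qed
    have "h p \<noteq> 0" using p P_def by auto
    have out: "h x = 0" if "x \<in> V" "x \<notin> P" for x
      using that P_def by auto
    have "m > 0" using p less.prems(1)[of p] P_def by force
    have sub: "{x \<in> V. h' x \<noteq> 0} \<subset> P"
      using p out unfolding h'_def by (auto simp: indicator_def P_def split: if_splits)
    have IH: "\<epsilon> * sum h' V \<le> (\<Sum>(x, y)\<in>A. max (h' x - h' y) 0)"
    proof (rule less.hyps)
      show "card {x \<in> V. h' x \<noteq> 0} < card {x \<in> V. h x \<noteq> 0}"
        using psubset_card_mono[OF finP sub] by (simp add: P_def)
      show "0 \<le> h' x" if "x \<in> V" for x
        using that m_le less.prems(1) by (auto simp: h'_def indicator_def)
      \<comment> \<open>Expansion is assumed for all subsets of the support, so it passes to the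
        smaller support of \<open>h'\<close>.\<close>
      show "\<epsilon> * real (card B) \<le> real (card {(x, y) \<in> A. x \<in> B \<and> y \<notin> B})"
        if "B \<subseteq> {x \<in> V. h' x \<noteq> 0}" for B
        by (rule less.prems(2)) (use that sub P_def in blast)
    qed
    have "sum h V = sum h' V + m * real (card P)"
    proof -
      have "(\<Sum>x\<in>V. indicator P x) = real (card P)"
        using finite_V finP
        by (subst sum.mono_neutral_cong_right[of V P _ "\<lambda>_. 1"]) (auto simp: P_def)
      then show ?thesis
        unfolding h'_def by (simp add: sum_subtractf sum_distrib_left[symmetric])
    qed
    moreover have "(\<Sum>(x, y)\<in>A. max (h x - h y) 0) =
        (\<Sum>(x, y)\<in>A. max (h' x - h' y) 0) + m * real (card {(x, y) \<in> A. x \<in> P \<and> y \<notin> P})"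
    proof -
      \<comment> \<open>Differences inside \<open>P\<close> are unchanged. An edge leaving
        \<open>P\<close> has \<open>h y = 0\<close> and \<open>h x \<ge> m\<close>, so its positive
        part drops by exactly \<open>m\<close>; all other edges contribute 0 on both sides.\<close>
      have "max (h x - h y) 0 = max (h' x - h' y) 0 + m * of_bool (x \<in> P \<and> y \<notin> P)"
        if "(x, y) \<in> A" for x y
        using that A_subset m_le[of x] m_le[of y] out[of x] out[of y] \<open>m > 0\<close>
        by (auto simp: h'_def indicator_def)
      then have "(\<Sum>(x, y)\<in>A. max (h x - h y) 0) =
          (\<Sum>(x, y)\<in>A. max (h' x - h' y) 0) + (\<Sum>(x, y)\<in>A. m * of_bool (x \<in> P \<and> y \<notin> P))"
        unfolding sum.distrib[symmetric] by (intro sum.cong) auto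
      also have "(\<Sum>(x, y)\<in>A. m * of_bool (x \<in> P \<and> y \<notin> P)) =
          m * real (card {(x, y) \<in> A. x \<in> P \<and> y \<notin> P})"
      proof -
        have "(\<Sum>(x, y)\<in>A. m * of_bool (x \<in> P \<and> y \<notin> P)) =
            (\<Sum>e\<in>{(x, y) \<in> A. x \<in> P \<and> y \<notin> P}. m)"
          using finite_A by (intro sum.mono_neutral_cong_right) auto
        then show ?thesis by (simp add: mult.commute)
      qed
      finally show ?thesis .
    qed
    \<comment> \<open>The expansion of the full support \<open>P\<close> pays for the layer of
      height \<open>m\<close> that was removed.\<close>
    moreover have "m * (\<epsilon> * real (card P)) \<le> m * real (card {(x, y) \<in> A. x \<in> P \<and> y \<notin> P})"
      using less.prems(2)[of P] \<open>m > 0\<close> by (intro mult_left_mono) (auto simp: P_def)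
    ultimately show ?thesis
      using IH by (simp add: algebra_simps)
  qed
qed

text \<open>The level-set inequality is applied to the squared modulus of \<open>g\<close>. A
  difference of squares factors, and Cauchy-Schwarz separates the energy from a sum bounded by
  \<open>4 * D * sqnorm g\<close>.\<close>

lemma cheeger:
  assumes "0 \<le> \<epsilon>"
    and "\<And>B. B \<subseteq> {x \<in> V. g x \<noteq> 0} \<Longrightarrow>
      \<epsilon> * real (card B) \<le> real (card {(x, y) \<in> A. x \<in> B \<and> y \<notin> B})"
  shows "\<epsilon>\<^sup>2 * sqnorm g \<le> 4 * D * energy g"
proof (cases "sqnorm g = 0")
  case True
  then show ?thesis using energy_nonneg D_pos by simp
next
  case False
  then have pos: "sqnorm g > 0" using sqnorm_nonneg[of g] by simp
  let ?h = "\<lambda>x. (cmod (g x))\<^sup>2"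
  let ?u = "\<lambda>(x, y). cmod (g x - g y)" and ?v = "\<lambda>(x, y). cmod (g x) + cmod (g y)"
  have "\<epsilon> * sqnorm g \<le> (\<Sum>(x, y)\<in>A. max (?h x - ?h y) 0)"
    unfolding sqnorm_def using assms(2) by (intro coarea) auto
  also have "\<dots> \<le> (\<Sum>e\<in>A. ?u e * ?v e)"
  proof (rule sum_mono, clarify)
    fix x y
    have "?h x - ?h y = (cmod (g x) - cmod (g y)) * (cmod (g x) + cmod (g y))"
      by (simp add: power2_eq_square algebra_simps)
    also have "\<dots> \<le> cmod (g x - g y) * (cmod (g x) + cmod (g y))"
      by (intro mult_right_mono norm_triangle_ineq2) auto
    finally show "max (?h x - ?h y) 0 \<le> cmod (g x - g y) * (cmod (g x) + cmod (g y))"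
      by simp
  qed
  finally have "(\<epsilon> * sqnorm g)\<^sup>2 \<le> (\<Sum>e\<in>A. ?u e * ?v e)\<^sup>2"
    using assms(1) sqnorm_nonneg by (intro power_mono) auto
  also have "\<dots> \<le> (\<Sum>e\<in>A. (?u e)\<^sup>2) * (\<Sum>e\<in>A. (?v e)\<^sup>2)"
    by (rule Cauchy_Schwarz_ineq_sum)
  also have "(\<Sum>e\<in>A. (?u e)\<^sup>2) = energy g"
    unfolding energy_def by (intro sum.cong) auto
  also have "energy g * (\<Sum>e\<in>A. (?v e)\<^sup>2) \<le> energy g * (4 * D * sqnorm g)"
  proof (rule mult_left_mono[OF _ energy_nonneg])
    have "(\<Sum>e\<in>A. (?v e)\<^sup>2) \<le> (\<Sum>(x, y)\<in>A. 2 * ?h x + 2 * ?h y)"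
    proof (rule sum_mono, clarify)
      fix x y
      show "(cmod (g x) + cmod (g y))\<^sup>2 \<le> 2 * ?h x + 2 * ?h y"
        using zero_le_power2[of "cmod (g x) - cmod (g y)"]
        by (simp add: power2_eq_square algebra_simps)
    qed
    also have "\<dots> = (\<Sum>(x, y)\<in>A. 2 * ?h x) + (\<Sum>(x, y)\<in>A. 2 * ?h y)"
      unfolding sum.distrib[symmetric] by (intro sum.cong) auto
    also have "(\<Sum>(x, y)\<in>A. 2 * ?h y) = (\<Sum>(x, y)\<in>A. 2 * ?h x)"
      by (rule sum_edges_swap)
    also have "(\<Sum>(x, y)\<in>A. 2 * ?h x) + (\<Sum>(x, y)\<in>A. 2 * ?h x) \<le> 2 * (D * (\<Sum>x\<in>V. 2 * ?h x))"
      using sum_edges_fst_le[of "\<lambda>x. 2 * ?h x"] by simp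
    also have "\<dots> = 4 * D * sqnorm g"
      by (simp add: sqnorm_def sum_distrib_left[symmetric])
    finally show "(\<Sum>e\<in>A. (?v e)\<^sup>2) \<le> 4 * D * sqnorm g" .
  qed
  \<comment> \<open>One factor \<open>sqnorm g\<close> cancels, which is why the case
    \<open>sqnorm g = 0\<close> was split off.\<close>
  finally have "sqnorm g * (\<epsilon>\<^sup>2 * sqnorm g) \<le> sqnorm g * (4 * D * energy g)"
    by (simp add: power2_eq_square algebra_simps)
  then show ?thesis
    using pos by simp
qed

text \<open>The Cheeger inequality bounds the energy loss of one step below by a fixed proportion of
  the squared norm.\<close>

lemma walk_contracts:
  assumes "0 \<le> \<epsilon>"
    and "\<And>B. B \<subseteq> {x \<in> V. g x \<noteq> 0} \<Longrightarrow>
      \<epsilon> * real (card B) \<le> real (card {(x, y) \<in> A. x \<in> B \<and> y \<notin> B})"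
  shows "sqnorm (walk g) \<le> (1 - \<epsilon>\<^sup>2 / (16 * D\<^sup>2)) * sqnorm g"
proof -
  have "\<epsilon>\<^sup>2 / (16 * D\<^sup>2) * sqnorm g = \<epsilon>\<^sup>2 * sqnorm g / (16 * D\<^sup>2)"
    by simp
  also have "\<dots> \<le> 4 * D * energy g / (16 * D\<^sup>2)"
    using cheeger[OF assms] by (intro divide_right_mono) auto
  also have "\<dots> = energy g / (4 * D)"
    using D_pos by (simp add: field_simps power2_eq_square)
  finally show ?thesis
    using sqnorm_walk_le[of g] by (simp add: left_diff_distrib)
qed

section \<open>Linearity and locality of the walk\<close>

lemma walk_const: "walk (\<lambda>_. c) = (\<lambda>_. c)"
  by (simp add: walk_def laplacian_def fun_eq_iff)

lemma walk_add: "walk (\<lambda>x. g x + h x) = (\<lambda>x. walk g x + walk h x)"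
proof -
  have "laplacian (\<lambda>x. g x + h x) = (\<lambda>x. laplacian g x + laplacian h x)"
    unfolding laplacian_def sum.distrib[symmetric] by (intro ext sum.cong) auto
  then show ?thesis by (simp add: walk_def fun_eq_iff add_divide_distrib)
qed

lemma walk_scale: "walk (\<lambda>x. c * g x) = (\<lambda>x. c * walk g x)"
proof -
  have "laplacian (\<lambda>x. c * g x) = (\<lambda>x. c * laplacian g x)"
    unfolding laplacian_def by (simp add: sum_distrib_left right_diff_distrib)
  then show ?thesis by (simp add: walk_def fun_eq_iff right_diff_distrib)
qed

lemma funpow_walk_const: "(walk ^^ n) (\<lambda>_. c) = (\<lambda>_. c)"
  by (induction n) (auto simp: walk_const)

lemma funpow_walk_add: "(walk ^^ n) (\<lambda>x. g x + h x) = (\<lambda>x. (walk ^^ n) g x + (walk ^^ n) h x)"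
  by (induction n) (auto simp: walk_add)

lemma funpow_walk_scale: "(walk ^^ n) (\<lambda>x. c * g x) = (\<lambda>x. c * (walk ^^ n) g x)"
  by (induction n) (auto simp: walk_scale)

lemma walk_cong:
  assumes "\<And>x. x \<in> V \<Longrightarrow> g x = h x" "x \<in> V"
  shows "walk g x = walk h x"
proof -
  have "laplacian g x = laplacian h x"
    unfolding laplacian_def using assms nbrs_subset[of x] by (intro sum.cong) auto
  then show ?thesis using assms by (simp add: walk_def)
qed

text \<open>Neighbours of points of \<open>V\<close> stay in \<open>V\<close>, so values elsewhere
  never enter. This lets the walk act on classes of functions that are determined only on
  \<open>V\<close>.\<close>

lemma funpow_walk_cong:
  assumes "\<And>x. x \<in> V \<Longrightarrow> g x = h x" "x \<in> V"
  shows "(walk ^^ n) g x = (walk ^^ n) h x"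
  using assms(2)
proof (induction n arbitrary: x)
  case (Suc n)
  then show ?case by (auto intro: walk_cong)
qed (use assms(1) in auto)

lemma walk_support:
  assumes "walk g x \<noteq> 0"
  shows "g x \<noteq> 0 \<or> (\<exists>y. (x, y) \<in> A \<and> g y \<noteq> 0)"
proof (rule ccontr)
  assume "\<not> ?thesis"
  then have "g x = 0" "laplacian g x = 0"
    unfolding laplacian_def by auto
  then show False using assms by (simp add: walk_def)
qed

end

section \<open>Propagation of supports and iterated contraction\<close>

locale metric_graph = bounded_degree_graph V A D
  for V :: "'a::metric_space set" and A D +
  fixes R :: real
  assumes A_dist: "(x, y) \<in> A \<Longrightarrow> dist x y \<le> R"
    and R_nonneg: "0 \<le> R"
begin

lemma funpow_walk_support:
  assumes "(walk ^^ n) g x \<noteq> 0" "x \<in> V"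
  shows "\<exists>y\<in>V. g y \<noteq> 0 \<and> dist x y \<le> real n * R"
  using assms
proof (induction n arbitrary: x)
  case 0
  then show ?case by auto
next
  case (Suc n)
  then have "walk ((walk ^^ n) g) x \<noteq> 0" by simp
  \<comment> \<open>The point \<open>z\<close> is either \<open>x\<close> itself, at distance 0, or
    a neighbour of \<open>x\<close>.\<close>
  from walk_support[OF this] obtain z where z: "z \<in> V" "(walk ^^ n) g z \<noteq> 0" "dist x z \<le> R"
    using Suc.prems(2) A_dist A_subset R_nonneg by force
  then obtain y where "y \<in> V" "g y \<noteq> 0" "dist z y \<le> real n * R"
    using Suc.IH by blast
  moreover have "dist x y \<le> dist x z + dist z y" by (rule dist_triangle)
  ultimately show ?case
    using z by (intro bexI[of _ y]) (auto simp: algebra_simps)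
qed

text \<open>After k \<le> n steps the support has spread by at most k R in each direction, so its
  diameter stays below \<open>S + 2 * real n * R\<close> and the one-step contraction applies every
  time.\<close>

lemma funpow_walk_contracts:
  assumes \<epsilon>: "0 \<le> \<epsilon>" and q: "1 - \<epsilon>\<^sup>2 / (16 * D\<^sup>2) \<le> q" "0 \<le> q"
    and expansion: "\<And>B. B \<subseteq> V \<Longrightarrow> (\<And>x y. x \<in> B \<Longrightarrow> y \<in> B \<Longrightarrow> dist x y \<le> S + 2 * real n * R) \<Longrightarrow>
      \<epsilon> * real (card B) \<le> real (card {(x, y) \<in> A. x \<in> B \<and> y \<notin> B})"
    and g: "\<And>x y. x \<in> V \<Longrightarrow> y \<in> V \<Longrightarrow> g x \<noteq> 0 \<Longrightarrow> g y \<noteq> 0 \<Longrightarrow> dist x y \<le> S"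
  shows "sqnorm ((walk ^^ n) g) \<le> q ^ n * sqnorm g"
proof -
  have "sqnorm ((walk ^^ k) g) \<le> q ^ k * sqnorm g" if "k \<le> n" for k
    using that
  proof (induction k)
    case (Suc k)
    let ?g = "(walk ^^ k) g"
    have "sqnorm (walk ?g) \<le> (1 - \<epsilon>\<^sup>2 / (16 * D\<^sup>2)) * sqnorm ?g"
    proof (rule walk_contracts[OF \<epsilon>], rule expansion)
      fix B x y
      assume B: "B \<subseteq> {x \<in> V. ?g x \<noteq> 0}"
      then show "B \<subseteq> V" by auto
      assume "x \<in> B" "y \<in> B"
      with B have xy: "x \<in> V" "?g x \<noteq> 0" "y \<in> V" "?g y \<noteq> 0" by auto
      obtain x' y' where *: "x' \<in> V" "y' \<in> V" "g x' \<noteq> 0" "g y' \<noteq> 0"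
          "dist x x' \<le> real k * R" "dist y y' \<le> real k * R"
        using funpow_walk_support[OF xy(2,1)] funpow_walk_support[OF xy(4,3)] by metis
      have "real k * R \<le> real n * R"
        using Suc.prems R_nonneg by (intro mult_right_mono) auto
      moreover have "dist x y \<le> dist x x' + dist x' y' + dist y' y"
        using dist_triangle[of x y x'] dist_triangle[of x' y y'] by linarith
      ultimately show "dist x y \<le> S + 2 * real n * R"
        using g[OF *(1-4)] *(5,6) by (simp add: dist_commute)
    qed
    also have "\<dots> \<le> q * sqnorm ?g"
      using q sqnorm_nonneg by (intro mult_right_mono) auto
    also have "\<dots> \<le> q * (q ^ k * sqnorm g)"
      using Suc q by (intro mult_left_mono) auto
    finally show ?case by simp
  qed simp
  then show ?thesis by simp
qed

end

section \<open>The Hilbert space of complex functions on a finite probability space\<close>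

text \<open>A copy of the complex numbers, realised as sequences concentrated at index 0 because
  \<open>ONL\<close> ranges over Hilbert spaces carried by this type; \<open>emb\<close> is the
  isomorphism.\<close>

definition complex_line :: "(nat \<Rightarrow> complex) hilbert" where
  "complex_line = \<lparr>
     hcarrier = {f. \<forall>n>0. f n = 0},
     hzero = (\<lambda>_. 0),
     hadd = (\<lambda>f g n. f n + g n),
     hscale = (\<lambda>a f n. a * f n),
     hinner = (\<lambda>f g. cnj (f 0) * g 0)\<rparr>"

definition emb :: "complex \<Rightarrow> nat \<Rightarrow> complex" where
  "emb z = (\<lambda>n. if n = 0 then z else 0)"

lemma emb_0 [simp]: "emb z 0 = z"
  by (simp add: emb_def)

lemma emb_eq_iff [simp]: "emb z = emb w \<longleftrightarrow> z = w"
  by (metis emb_0)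

lemma emb_fun_eq_iff [simp]: "(\<lambda>x. emb (g x)) = (\<lambda>x. emb (h x)) \<longleftrightarrow> g = h"
proof
  assume eq: "(\<lambda>x. emb (g x)) = (\<lambda>x. emb (h x))"
  show "g = h"
    using fun_cong[OF eq] by (intro ext) simp
qed simp

lemma hcarrier_complex_line: "hcarrier complex_line = range emb"
proof -
  have "f = emb (f 0)" if "\<forall>n>0. f n = 0" for f :: "nat \<Rightarrow> complex"
    using that by (auto simp: emb_def fun_eq_iff)
  then show ?thesis
    by (auto simp: complex_line_def emb_def)
qed

lemma emb_in_complex_line [simp]: "emb z \<in> hcarrier complex_line"
  by (simp add: hcarrier_complex_line)

lemma hzero_complex_line: "hzero complex_line = emb 0"
  by (simp add: complex_line_def emb_def)

lemma hadd_emb [simp]: "hadd complex_line (emb z) (emb w) = emb (z + w)"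
  by (auto simp: complex_line_def emb_def)

lemma hscale_emb [simp]: "hscale complex_line a (emb z) = emb (a * z)"
  by (auto simp: complex_line_def emb_def)

lemma hinner_emb [simp]: "hinner complex_line (emb z) (emb w) = cnj z * w"
  by (simp add: complex_line_def)

lemma hminus_emb [simp]: "hminus complex_line (emb z) (emb w) = emb (z - w)"
  by (simp add: hminus_def)

lemma hnorm_emb [simp]: "hnorm complex_line (emb z) = cmod z"
  by (simp add: hnorm_def cmod_power2 power2_eq_square cmod_def)

lemma hdist_complex_line: "hdist complex_line f g = cmod (f 0 - g 0)"
proof -
  have "hdist complex_line f g = sqrt (Re (cnj (f 0 - g 0) * (f 0 - g 0)))"
    by (simp add: hdist_def hnorm_def hminus_def complex_line_def)
  then show ?thesis
    by (simp add: cmod_def power2_eq_square algebra_simps)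
qed

interpretation complex_line: Metric_space "hcarrier complex_line" "hdist complex_line"
proof
  fix f g h :: "nat \<Rightarrow> complex"
  show "0 \<le> hdist complex_line f g" "hdist complex_line f g = hdist complex_line g f"
    by (simp_all add: hdist_complex_line norm_minus_commute)
  show "hdist complex_line f g = 0 \<longleftrightarrow> f = g"
    if "f \<in> hcarrier complex_line" "g \<in> hcarrier complex_line"
    using that by (auto simp: hdist_complex_line hcarrier_complex_line)
  show "hdist complex_line f h \<le> hdist complex_line f g + hdist complex_line g h"
    using norm_triangle_ineq[of "f 0 - g 0" "g 0 - h 0"] by (simp add: hdist_complex_line)
qed

lemma mcomplete_complex_line: "complex_line.mcomplete"
  unfolding complex_line.mcomplete_def
proof (intro allI impI)
  fix \<sigma>
  assume \<sigma>: "complex_line.MCauchy \<sigma>"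
  have "Cauchy (\<lambda>n. \<sigma> n 0)"
  proof (rule metric_CauchyI)
    fix e :: real
    assume "e > 0"
    with \<sigma> obtain N where "\<forall>m n. N \<le> m \<longrightarrow> N \<le> n \<longrightarrow> cmod (\<sigma> m 0 - \<sigma> n 0) < e"
      unfolding complex_line.MCauchy_def hdist_complex_line by meson
    then show "\<exists>N. \<forall>m\<ge>N. \<forall>n\<ge>N. dist (\<sigma> m 0) (\<sigma> n 0) < e"
      by (auto simp: dist_norm)
  qed
  then obtain z where "(\<lambda>n. \<sigma> n 0) \<longlonglongrightarrow> z"
    using Cauchy_convergent convergent_def by blast
  then have "\<forall>\<^sub>F n in sequentially. cmod (\<sigma> n 0 - z) < e" if "e > 0" for e
    using that by (simp add: tendsto_iff dist_norm)
  moreover have "\<sigma> n \<in> hcarrier complex_line" for n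
    using \<sigma> by (auto simp: complex_line.MCauchy_def)
  ultimately have "limitin complex_line.mtopology \<sigma> (emb z) sequentially"
    by (simp add: complex_line.limitin_metric hdist_complex_line)
  then show "\<exists>x. limitin complex_line.mtopology \<sigma> x sequentially" by blast
qed

text \<open>Separability is inherited from the complex plane through the continuous surjection
  \<open>emb\<close>.\<close>

lemma separable_complex_line: "separable_space complex_line.mtopology"
proof (rule separable_space_continuous_map_image)
  show "separable_space (euclidean :: complex topology)"
  proof -
    obtain D :: "complex set" where "countable D" "\<And>X. open X \<Longrightarrow> X \<noteq> {} \<Longrightarrow> \<exists>d\<in>D. d \<in> X"
      using countable_dense_setE by blast
    then show ?thesis
      unfolding separable_space_def by (intro exI[of _ D]) (auto simp: closure_of_def)
  qed
  show "continuous_map euclidean complex_line.mtopology emb"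
    unfolding complex_line.continuous_map_to_metric
  proof (intro ballI allI impI)
    fix z :: complex and e :: real
    assume "e > 0"
    then show "\<exists>U. openin euclidean U \<and> z \<in> U \<and> (\<forall>w\<in>U. emb w \<in> complex_line.mball (emb z) e)"
      by (intro exI[of _ "ball z e"]) (simp add: hdist_complex_line dist_norm)
  qed
  show "emb ` topspace euclidean = topspace complex_line.mtopology"
    unfolding complex_line.topspace_mtopology by (simp add: hcarrier_complex_line)
qed

lemma nonzero_separable_complex_line: "nonzero_separable_hilbert complex_line"
proof -
  have "complex_hilbert_space complex_line"
  proof
    show "\<exists>w\<in>hcarrier complex_line. hadd complex_line v w = hzero complex_line"
      if "v \<in> hcarrier complex_line" for v
    proof -
      from that obtain z where "v = emb z" by (auto simp: hcarrier_complex_line)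
      then show ?thesis by (intro bexI[of _ "emb (- z)"]) (auto simp: hzero_complex_line)
    qed
    show "complex_line.mcomplete" by (rule mcomplete_complex_line)
    show "hinner complex_line v v = 0 \<longleftrightarrow> v = hzero complex_line"
      if "v \<in> hcarrier complex_line" for v
      using that by (auto simp: hcarrier_complex_line hzero_complex_line)
  qed (auto simp: complex_line_def algebra_simps)
  moreover have "\<exists>v\<in>hcarrier complex_line. v \<noteq> hzero complex_line"
    by (intro bexI[of _ "emb 1"]) (auto simp: hzero_complex_line)
  ultimately show ?thesis
    using separable_complex_line by (simp add: nonzero_separable_hilbert_def)
qed

section \<open>Square-summable functions for a finitely supported measure\<close>

locale finite_support =
  fixes \<mu> :: "'a pmf"
  assumes finite_set_pmf: "finite (set_pmf \<mu>)"
begin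

lemma infsum_pmf:
  fixes f :: "'a \<Rightarrow> 'b::real_normed_algebra_1"
  shows "(\<Sum>\<^sub>\<infinity>x. of_real (pmf \<mu> x) * f x) = (\<Sum>x\<in>set_pmf \<mu>. of_real (pmf \<mu> x) * f x)"
proof -
  have "(\<Sum>\<^sub>\<infinity>x. of_real (pmf \<mu> x) * f x) = (\<Sum>\<^sub>\<infinity>x\<in>set_pmf \<mu>. of_real (pmf \<mu> x) * f x)"
    by (intro infsum_cong_neutral) (auto simp: set_pmf_eq)
  then show ?thesis using finite_set_pmf by simp
qed

lemma infsum_pmf_real: "(\<Sum>\<^sub>\<infinity>x. pmf \<mu> x * f x) = (\<Sum>x\<in>set_pmf \<mu>. pmf \<mu> x * f x)"
  using infsum_pmf[of f] by simp

lemma summable_pmf: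
  fixes f :: "'a \<Rightarrow> real"
  shows "(\<lambda>x. pmf \<mu> x * f x) summable_on UNIV"
proof -
  have "(\<lambda>x. pmf \<mu> x * f x) summable_on set_pmf \<mu>"
    using finite_set_pmf by simp
  then show ?thesis
    by (rule summable_on_cong_neutral[THEN iffD1, rotated -1]) (auto simp: set_pmf_eq)
qed

lemma l2_fun_line: "l2_fun \<mu> complex_line = range (\<lambda>g x. emb (g x))"
proof -
  have "\<phi> \<in> range (\<lambda>g x. emb (g x))" if "\<forall>x. \<phi> x \<in> hcarrier complex_line" for \<phi> :: "'a \<Rightarrow> nat \<Rightarrow> complex"
  proof -
    have "\<phi> x = emb (\<phi> x 0)" for x
      using that[rule_format, of x] by (auto simp: hcarrier_complex_line)
    then show ?thesis by (intro image_eqI[of _ _ "\<lambda>x. \<phi> x 0"]) auto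
  qed
  then show ?thesis
    unfolding l2_fun_def using summable_pmf by auto
qed

text \<open>All weights on the support are positive, so the weighted sum of squares vanishes only if
  every term does.\<close>

lemma l2_rel_line:
  "l2_rel \<mu> complex_line =
    {(\<lambda>x. emb (g x), \<lambda>x. emb (h x)) | g h. \<forall>x\<in>set_pmf \<mu>. g x = h x}"
proof -
  have "(\<Sum>x\<in>set_pmf \<mu>. pmf \<mu> x * (cmod (g x - h x))\<^sup>2) = 0 \<longleftrightarrow> (\<forall>x\<in>set_pmf \<mu>. g x = h x)" for g h
    using finite_set_pmf by (subst sum_nonneg_eq_0_iff) (auto simp: set_pmf_eq)
  then show ?thesis
    unfolding l2_rel_def l2_fun_line infsum_pmf_real by fastforce
qed

text \<open>These classes exhaust the quotient, so its structure can be computed on scalar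
  functions.\<close>

definition cls :: "('a \<Rightarrow> complex) \<Rightarrow> ('a \<Rightarrow> nat \<Rightarrow> complex) set" where
  "cls g = l2_class \<mu> complex_line (\<lambda>x. emb (g x))"

lemma cls_eq: "cls g = {\<lambda>x. emb (h x) | h. \<forall>x\<in>set_pmf \<mu>. g x = h x}"
  unfolding cls_def l2_class_def l2_rel_line by auto

lemma cls_eq_iff: "cls g = cls h \<longleftrightarrow> (\<forall>x\<in>set_pmf \<mu>. g x = h x)"
proof
  assume "cls g = cls h"
  moreover have "(\<lambda>x. emb (h x)) \<in> cls h" by (auto simp: cls_eq)
  ultimately have "(\<lambda>x. emb (h x)) \<in> cls g" by simp
  then show "\<forall>x\<in>set_pmf \<mu>. g x = h x" unfolding cls_eq by auto
next
  assume "\<forall>x\<in>set_pmf \<mu>. g x = h x"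
  then show "cls g = cls h" unfolding cls_eq by auto
qed

lemma cls_nonempty: "cls g \<noteq> {}"
  by (auto simp: cls_eq)

lemma hcarrier_l2_line: "hcarrier (l2 \<mu> complex_line) = range cls"
  unfolding l2_def quotient_def l2_fun_line by (auto simp: cls_def l2_class_def)

text \<open>All representatives give the same class, so the nonempty union in \<open>l2\<close>
  collapses to it.\<close>

lemma hadd_cls: "hadd (l2 \<mu> complex_line) (cls g) (cls h) = cls (\<lambda>x. g x + h x)"
proof -
  have "l2_class \<mu> complex_line (\<lambda>x. hadd complex_line (\<phi> x) (\<psi> x)) = cls (\<lambda>x. g x + h x)"
    if "\<phi> \<in> cls g" "\<psi> \<in> cls h" for \<phi> \<psi>
  proof -
    obtain g' h' where "\<phi> = (\<lambda>x. emb (g' x))" "\<psi> = (\<lambda>x. emb (h' x))"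
        "\<forall>x\<in>set_pmf \<mu>. g x = g' x" "\<forall>x\<in>set_pmf \<mu>. h x = h' x"
      using \<open>\<phi> \<in> cls g\<close> \<open>\<psi> \<in> cls h\<close> unfolding cls_eq by blast
    then show ?thesis
      by (simp add: cls_eq_iff flip: cls_def)
  qed
  then show ?thesis
    using cls_nonempty by (simp add: l2_def)
qed

lemma hscale_cls: "hscale (l2 \<mu> complex_line) a (cls g) = cls (\<lambda>x. a * g x)"
proof -
  have "l2_class \<mu> complex_line (\<lambda>x. hscale complex_line a (\<phi> x)) = cls (\<lambda>x. a * g x)"
    if "\<phi> \<in> cls g" for \<phi>
  proof -
    obtain g' where "\<phi> = (\<lambda>x. emb (g' x))" "\<forall>x\<in>set_pmf \<mu>. g x = g' x"
      using \<open>\<phi> \<in> cls g\<close> unfolding cls_eq by blast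
    then show ?thesis
      by (simp add: cls_eq_iff flip: cls_def)
  qed
  then show ?thesis
    using cls_nonempty by (simp add: l2_def)
qed

lemma hinner_cls:
  "hinner (l2 \<mu> complex_line) (cls g) (cls h) =
    (\<Sum>x\<in>set_pmf \<mu>. complex_of_real (pmf \<mu> x) * (cnj (g x) * h x))" (is "_ = ?s")
proof -
  have "(\<Sum>\<^sub>\<infinity>x. complex_of_real (pmf \<mu> x) * hinner complex_line (\<phi> x) (\<psi> x)) = ?s"
    if "\<phi> \<in> cls g" "\<psi> \<in> cls h" for \<phi> \<psi>
    unfolding infsum_pmf using that by (auto simp: cls_eq intro!: sum.cong)
  then have "(\<Union>\<phi>\<in>cls g. \<Union>\<psi>\<in>cls h.
      {\<Sum>\<^sub>\<infinity>x. complex_of_real (pmf \<mu> x) * hinner complex_line (\<phi> x) (\<psi> x)}) = {?s}"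
    using cls_nonempty by simp
  then show ?thesis by (simp add: l2_def)
qed

lemma hnorm_cls: "hnorm (l2 \<mu> complex_line) (cls g) = sqrt (\<Sum>x\<in>set_pmf \<mu>. pmf \<mu> x * (cmod (g x))\<^sup>2)"
  unfolding hnorm_def hinner_cls
  by (simp add: cmod_power2 flip: power2_eq_square)

lemma l2_val_cls:
  assumes "x \<in> set_pmf \<mu>"
  shows "l2_val (cls g) x = emb (g x)"
  unfolding l2_val_def
  by (rule the_elem_image_unique[OF cls_nonempty]) (use assms in \<open>auto simp: cls_eq\<close>)

lemma l2_supp_cls: "l2_supp \<mu> complex_line (cls g) = {x \<in> set_pmf \<mu>. g x \<noteq> 0}"
proof -
  have "pmf \<mu> x > 0 \<longleftrightarrow> x \<in> set_pmf \<mu>" for x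
    by (simp add: set_pmf_iff order_less_le)
  then show ?thesis
    by (auto simp: l2_supp_def l2_val_cls hzero_complex_line)
qed

text \<open>\<open>l2_val\<close> picks a scalar representative. Its values off the support of the
  measure are unspecified, hence the congruence condition \<open>T_cong\<close> on which the lemmas
  below rest.\<close>

definition lift_op ::
  "(('a \<Rightarrow> complex) \<Rightarrow> 'a \<Rightarrow> complex) \<Rightarrow> ('a \<Rightarrow> nat \<Rightarrow> complex) set \<Rightarrow> ('a \<Rightarrow> nat \<Rightarrow> complex) set" where
  "lift_op T \<Phi> = cls (T (\<lambda>x. l2_val \<Phi> x 0))"

context
  fixes T :: "('a \<Rightarrow> complex) \<Rightarrow> 'a \<Rightarrow> complex"
  assumes T_cong: "\<And>g h x. (\<And>y. y \<in> set_pmf \<mu> \<Longrightarrow> g y = h y) \<Longrightarrow> x \<in> set_pmf \<mu> \<Longrightarrow> T g x = T h x"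
begin

lemma lift_op_cls: "lift_op T (cls g) = cls (T g)"
  unfolding lift_op_def cls_eq_iff by (intro ballI T_cong) (simp_all add: l2_val_cls)

lemma bounded_lift_op:
  assumes add: "\<And>g h. T (\<lambda>x. g x + h x) = (\<lambda>x. T g x + T h x)"
    and scale: "\<And>a g. T (\<lambda>x. a * g x) = (\<lambda>x. a * T g x)"
    and bound: "\<And>g. hnorm (l2 \<mu> complex_line) (cls (T g)) \<le> K * hnorm (l2 \<mu> complex_line) (cls g)"
  shows "bounded_op (l2 \<mu> complex_line) (lift_op T)"
  unfolding bounded_op_def hcarrier_l2_line
  by (auto simp: lift_op_cls hadd_cls hscale_cls add scale intro!: exI[of _ K] bound)

lemma matrix_entry_lift_op:
  assumes "x \<in> set_pmf \<mu>"
  shows "matrix_entry \<mu> complex_line (lift_op T) x y (emb v) = emb (T (\<lambda>z. if z = y then v else 0) x)"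
proof -
  have "(\<lambda>z. if z = y then emb v else hzero complex_line) = (\<lambda>z. emb (if z = y then v else 0))"
    by (auto simp: hzero_complex_line)
  then show ?thesis
    using assms by (simp add: matrix_entry_def lift_op_cls l2_val_cls flip: cls_def)
qed

end

end

text \<open>A real supremum dominates its members only when the set is bounded above; boundedness of
  \<open>T\<close> supplies this.\<close>

lemma op_norm_ge:
  assumes "bounded_op H T" "v \<in> hcarrier H" "hnorm H v \<le> 1"
    and "\<And>w. w \<in> hcarrier H \<Longrightarrow> 0 \<le> hnorm H w"
  shows "hnorm H (T v) \<le> op_norm H T"
proof -
  from assms(1) obtain K where K: "\<And>v. v \<in> hcarrier H \<Longrightarrow> hnorm H (T v) \<le> K * hnorm H v"
    unfolding bounded_op_def by blast
  \<comment> \<open>The absolute value is taken because the constant \<open>K\<close> is not known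
    to be nonnegative.\<close>
  have "hnorm H (T w) \<le> \<bar>K\<bar>" if "w \<in> hcarrier H" "hnorm H w \<le> 1" for w
  proof -
    have "K * hnorm H w \<le> \<bar>K\<bar> * 1"
      using that assms(4) by (intro mult_mono) auto
    then show ?thesis using K[OF that(1)] by linarith
  qed
  then show ?thesis
    unfolding op_norm_def using assms by (intro cSUP_upper bdd_aboveI[of _ "\<bar>K\<bar>"]) auto
qed

section \<open>From localisation to amenability\<close>

text \<open>Nonnegativity of \<open>S\<close> covers the empty set, whose diameter is 0 by
  convention.\<close>

lemma diameter_le_dist:
  assumes "0 \<le> S" "\<And>x y. x \<in> B \<Longrightarrow> y \<in> B \<Longrightarrow> dist x y \<le> S"
  shows "diameter B \<le> S"
  using assms unfolding diameter_def by (auto intro!: cSUP_least)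

definition metric_edges :: "real \<Rightarrow> 'a::metric_space set \<Rightarrow> ('a \<times> 'a) set" where
  "metric_edges R F = {(x, y). x \<in> F \<and> y \<in> F \<and> dist x y \<le> R}"

text \<open>\<open>B\<close> is finite, so the distance from a boundary point to \<open>B\<close> is
  attained. Each boundary point in \<open>F\<close> is thus the endpoint of an edge leaving
  \<open>B\<close>.\<close>

lemma card_bdry_le_edges:
  assumes "finite F" "B \<subseteq> F"
  shows "card (bdry R B \<inter> F) \<le> card {(x, y) \<in> metric_edges R F. x \<in> B \<and> y \<notin> B}"
proof -
  have fin: "finite {(x, y) \<in> metric_edges R F. x \<in> B \<and> y \<notin> B}"
    by (rule finite_subset[of _ "F \<times> F"]) (use assms in \<open>auto simp: metric_edges_def\<close>)
  have "bdry R B \<inter> F \<subseteq> snd ` {(x, y) \<in> metric_edges R F. x \<in> B \<and> y \<notin> B}"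
  proof
    fix y
    assume y: "y \<in> bdry R B \<inter> F"
    then have "B \<noteq> {}" "infdist y B \<le> R" by (auto simp: bdry_def nbhd_def)
    moreover have "finite B" using assms finite_subset by blast
    ultimately have "infdist y B = Min (dist y ` B)"
      by (simp add: infdist_notempty cInf_eq_Min)
    also have "\<dots> \<in> dist y ` B"
      using \<open>finite B\<close> \<open>B \<noteq> {}\<close> by (intro Min_in) auto
    finally obtain x where "x \<in> B" "dist y x \<le> R"
      using \<open>infdist y B \<le> R\<close> by auto
    then show "y \<in> snd ` {(x, y) \<in> metric_edges R F. x \<in> B \<and> y \<notin> B}"
      using y assms by (intro image_eqI[of _ _ "(x, y)"]) (auto simp: metric_edges_def bdry_def dist_commute)
  qed
  then show ?thesis
    using fin by (meson card_image_le card_mono finite_imageI order_trans)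
qed

lemma metric_graph_metric_edges:
  assumes "finite F" "D > 0" "0 \<le> R"
    and "\<And>x. x \<in> F \<Longrightarrow> finite (cball x R) \<and> real (card (cball x R)) \<le> D"
  shows "metric_graph F (metric_edges R F) D R"
proof
  fix x
  assume "x \<in> F"
  moreover have "metric_edges R F `` {x} \<subseteq> cball x R"
    by (auto simp: metric_edges_def)
  ultimately show "real (card (metric_edges R F `` {x})) \<le> D"
    using assms(4) card_mono order_trans of_nat_le_iff by metis
qed (use assms in \<open>auto simp: metric_edges_def sym_def dist_commute\<close>)

section \<open>The walk as an operator of finite propagation\<close>

lemma (in bounded_degree_graph) hnorm_cls_uniform:
  assumes "V \<noteq> {}"
  shows "hnorm (l2 (pmf_of_set V) complex_line) (finite_support.cls (pmf_of_set V) g) =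
    sqrt (sqnorm g / real (card V))"
proof -
  interpret finite_support "pmf_of_set V"
    by unfold_locales (simp add: assms finite_V)
  show ?thesis
    using assms finite_V by (simp add: hnorm_cls sqnorm_def sum_divide_distrib)
qed

text \<open>A column of the matrix is the iterated walk applied to a function supported at
  \<open>y\<close>, which spreads no further than \<open>real n * R\<close>.\<close>

lemma (in metric_graph) funpow_walk_finite_prop:
  assumes "V \<noteq> {}"
  defines "\<mu> \<equiv> pmf_of_set V"
  shows "finite_support.lift_op \<mu> (walk ^^ n) \<in> finite_prop_ops (real n * R) \<mu> complex_line"
proof -
  have set: "set_pmf \<mu> = V"
    unfolding \<mu>_def using assms(1) finite_V by simp
  interpret finite_support \<mu>
    by unfold_locales (simp add: set finite_V)
  have norm: "hnorm (l2 \<mu> complex_line) (cls g) = sqrt (sqnorm g / real (card V))" for g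
    unfolding \<mu>_def using assms(1) by (rule hnorm_cls_uniform)
  have cong: "(walk ^^ n) g x = (walk ^^ n) h x"
    if "\<And>y. y \<in> set_pmf \<mu> \<Longrightarrow> g y = h y" "x \<in> set_pmf \<mu>" for g h x
    using that unfolding set by (rule funpow_walk_cong)
  have "bounded_op (l2 \<mu> complex_line) (lift_op (walk ^^ n))"
    by (rule bounded_lift_op[where K = 1])
       (auto intro: cong simp: funpow_walk_add funpow_walk_scale norm
         sqnorm_funpow_walk_le_sqnorm divide_right_mono)
  moreover have "matrix_entry \<mu> complex_line (lift_op (walk ^^ n)) x y v = hzero complex_line"
    if xy: "x \<in> set_pmf \<mu>" "dist x y > real n * R" and v: "v \<in> hcarrier complex_line" for x y v
  proof -
    obtain z where z: "v = emb z" using v by (auto simp: hcarrier_complex_line)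
    have "(walk ^^ n) (\<lambda>w. if w = y then z else 0) x = 0"
    proof (rule ccontr)
      assume "(walk ^^ n) (\<lambda>w. if w = y then z else 0) x \<noteq> 0"
      from funpow_walk_support[OF this] xy set show False
        by (auto split: if_splits)
    qed
    moreover have "matrix_entry \<mu> complex_line (lift_op (walk ^^ n)) x y (emb z) =
        emb ((walk ^^ n) (\<lambda>w. if w = y then z else 0) x)"
      using cong xy(1) by (rule matrix_entry_lift_op)
    ultimately show ?thesis
      by (simp add: z hzero_complex_line)
  qed
  ultimately show ?thesis
    unfolding finite_prop_ops_def by auto
qed

text \<open>The constant function has norm 1 and is fixed by the walk, so the operator norm is at least 1.\<close>

lemma (in metric_graph) localised_sqnorm_lower_bound:
  fixes n :: nat
  assumes "V \<noteq> {}" "0 \<le> c"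
  defines "\<mu> \<equiv> pmf_of_set V"
  defines "T \<equiv> finite_support.lift_op \<mu> (walk ^^ n)"
  assumes \<phi>: "\<phi> \<in> hcarrier (l2 \<mu> complex_line)" "hnorm (l2 \<mu> complex_line) \<phi> = 1"
      "bounded (l2_supp \<mu> complex_line \<phi>)" "diameter (l2_supp \<mu> complex_line \<phi>) \<le> S"
    and loc: "c * op_norm (l2 \<mu> complex_line) T \<le> hnorm (l2 \<mu> complex_line) (T \<phi>)"
  obtains g where "sqnorm g > 0" "c\<^sup>2 * sqnorm g \<le> sqnorm ((walk ^^ n) g)"
    "\<And>x y. x \<in> V \<Longrightarrow> y \<in> V \<Longrightarrow> g x \<noteq> 0 \<Longrightarrow> g y \<noteq> 0 \<Longrightarrow> dist x y \<le> S"
proof -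
  let ?H = "l2 \<mu> complex_line"
  have set: "set_pmf \<mu> = V"
    unfolding \<mu>_def using assms(1) finite_V by simp
  interpret finite_support \<mu>
    by unfold_locales (simp add: set finite_V)
  have card_pos: "card V > 0"
    using assms(1) finite_V by (simp add: card_gt_0_iff)
  have norm: "hnorm ?H (cls g) = sqrt (sqnorm g / real (card V))" for g
    unfolding \<mu>_def using assms(1) by (rule hnorm_cls_uniform)
  have T_cls: "T (cls g) = cls ((walk ^^ n) g)" for g
    unfolding T_def by (rule lift_op_cls) (metis funpow_walk_cong set)
  have "hnorm ?H (cls (\<lambda>_. 1)) = 1"
    using card_pos by (simp add: norm sqnorm_def)
  moreover have "bounded_op ?H T"
    using funpow_walk_finite_prop[OF assms(1), of n]
    unfolding finite_prop_ops_def T_def \<mu>_def by blast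
  moreover have "0 \<le> hnorm ?H w" if "w \<in> hcarrier ?H" for w
    using that sqnorm_nonneg by (auto simp: hcarrier_l2_line norm)
  ultimately have "1 \<le> op_norm ?H T"
    using op_norm_ge[of ?H T "cls (\<lambda>_. 1)"]
    by (simp add: hcarrier_l2_line T_cls funpow_walk_const)
  then have "c * 1 \<le> c * op_norm ?H T"
    using assms(2) by (intro mult_left_mono)
  also note loc
  finally have c: "c \<le> hnorm ?H (T \<phi>)" by simp
  obtain g where g: "\<phi> = cls g"
    using \<phi>(1) by (auto simp: hcarrier_l2_line)
  \<comment> \<open>The unit norm of \<phi> fixes the scale of \<open>g\<close>, so the factor
    \<open>card V\<close> of the uniform measure drops out of the final estimate.\<close>
  have "sqnorm g = real (card V)"
    using \<phi>(2) card_pos by (simp add: g norm)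
  moreover have "c\<^sup>2 \<le> sqnorm ((walk ^^ n) g) / real (card V)"
  proof -
    have "c\<^sup>2 \<le> (sqrt (sqnorm ((walk ^^ n) g) / real (card V)))\<^sup>2"
      using c assms(2) by (intro power_mono) (auto simp: g T_cls norm)
    then show ?thesis
      using sqnorm_nonneg by simp
  qed
  moreover have "dist x y \<le> S" if "x \<in> V" "y \<in> V" "g x \<noteq> 0" "g y \<noteq> 0" for x y
  proof -
    have "x \<in> l2_supp \<mu> complex_line \<phi>" "y \<in> l2_supp \<mu> complex_line \<phi>"
      using that by (auto simp: g l2_supp_cls set)
    then show ?thesis
      using diameter_bounded_bound[OF \<phi>(3)] \<phi>(4) by fastforce
  qed
  ultimately show thesis
    using card_pos by (intro that[of g]) (auto simp: field_simps)
qed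

theorem theorem3p12:
  assumes "bounded_geometry TYPE('a::metric_space)"
    and "ONL TYPE('a)"
  shows "ULA TYPE('a)"
  unfolding ULA_def
proof (intro allI impI)
  fix R \<epsilon> :: real
  assume R: "R > 0" and \<epsilon>: "\<epsilon> > 0"
  obtain N :: nat where N: "\<And>x::'a. finite (cball x R) \<and> card (cball x R) \<le> N"
    using assms(1) R unfolding bounded_geometry_def by blast
  define D where "D = max 1 (real N)"
  have D: "D > 0" "\<And>x::'a. finite (cball x R) \<and> real (card (cball x R)) \<le> D"
    using N by (auto simp: D_def intro: max.coboundedI2)
  \<comment> \<open>The maximum with 0 keeps the powers of \<open>q\<close> monotone even when
    \<epsilon> is so large that the contraction factor is negative.\<close>
  define q where "q = max 0 (1 - \<epsilon>\<^sup>2 / (16 * D\<^sup>2))"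
  have q: "0 \<le> q" "q < 1" "1 - \<epsilon>\<^sup>2 / (16 * D\<^sup>2) \<le> q"
    using \<epsilon> D by (auto simp: q_def)
  obtain c where c: "c > 0"
    and onl: "\<forall>R>0. \<exists>S>0. \<forall>(\<mu> :: 'a pmf) (H :: (nat \<Rightarrow> complex) hilbert) T.
       nonzero_separable_hilbert H \<and> T \<in> finite_prop_ops R \<mu> H \<longrightarrow>
       (\<exists>\<phi>\<in>hcarrier (l2 \<mu> H). hnorm (l2 \<mu> H) \<phi> = 1 \<and>
          bounded (l2_supp \<mu> H \<phi>) \<and> diameter (l2_supp \<mu> H \<phi>) \<le> S \<and>
          hnorm (l2 \<mu> H) (T \<phi>) \<ge> c * op_norm (l2 \<mu> H) T)"
    using assms(2) unfolding ONL_def by blast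
  \<comment> \<open>The number of steps depends only on \<open>c\<close> and \<open>q\<close>,
    before any localisation radius is chosen. Its positivity makes \<open>real n * R\<close> an
    admissible propagation.\<close>
  obtain n where n: "n > 0" "q ^ n < c\<^sup>2"
  proof -
    obtain k where "q ^ k < c\<^sup>2"
      using real_arch_pow_inv[of "c\<^sup>2" q] c q by auto
    moreover have "q ^ Suc k \<le> q ^ k"
      using q by (intro power_decreasing) auto
    ultimately show thesis using that[of "Suc k"] by linarith
  qed
  obtain S where S: "S > 0" and onl_S: "\<And>(\<mu> :: 'a pmf) (H :: (nat \<Rightarrow> complex) hilbert) T.
      nonzero_separable_hilbert H \<Longrightarrow> T \<in> finite_prop_ops (real n * R) \<mu> H \<Longrightarrow>
       (\<exists>\<phi>\<in>hcarrier (l2 \<mu> H). hnorm (l2 \<mu> H) \<phi> = 1 \<and>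
          bounded (l2_supp \<mu> H \<phi>) \<and> diameter (l2_supp \<mu> H \<phi>) \<le> S \<and>
          hnorm (l2 \<mu> H) (T \<phi>) \<ge> c * op_norm (l2 \<mu> H) T)"
    using onl[rule_format, of "real n * R"] R n by auto
  \<comment> \<open>This bounds the diameter of the support during all n steps and does not depend
    on \<open>F\<close>, as uniformity requires.\<close>
  let ?S' = "S + 2 * real n * R"
  have S': "?S' > 0" using S R by (simp add: add_pos_nonneg)
  show "\<exists>S>0. \<forall>F::'a set. finite F \<and> F \<noteq> {} \<longrightarrow>
      (\<exists>E. finite E \<and> diameter E \<le> S \<and>
           real (card (bdry R E \<inter> F)) < \<epsilon> * real (card (E \<inter> F)))"
  proof (intro exI[of _ ?S'] conjI S' allI impI, rule ccontr)
    fix F :: "'a set"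
    assume F: "finite F \<and> F \<noteq> {}"
      and "\<nexists>E. finite E \<and> diameter E \<le> ?S' \<and>
        real (card (bdry R E \<inter> F)) < \<epsilon> * real (card (E \<inter> F))"
    then have not_ula: "\<epsilon> * real (card (E \<inter> F)) \<le> real (card (bdry R E \<inter> F))"
      if "finite E" "diameter E \<le> ?S'" for E
      using that by force
    interpret metric_graph F "metric_edges R F" D R
      using F D R by (intro metric_graph_metric_edges) auto
    \<comment> \<open>Since no set of diameter at most \<open>?S'\<close> witnesses amenability for
      \<open>F\<close>, each such subset has a large vertex boundary in \<open>F\<close>, hence a
      large edge boundary.\<close>
    have expansion: "\<epsilon> * real (card B) \<le>
        real (card {(x, y) \<in> metric_edges R F. x \<in> B \<and> y \<notin> B})"
      if "B \<subseteq> F" "\<And>x y. x \<in> B \<Longrightarrow> y \<in> B \<Longrightarrow> dist x y \<le> ?S'" for B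
    proof -
      have "\<epsilon> * real (card B) = \<epsilon> * real (card (B \<inter> F))"
        using that(1) by (simp add: Int_absorb2)
      also have "\<dots> \<le> real (card (bdry R B \<inter> F))"
        using that S' F by (intro not_ula diameter_le_dist) (auto intro: finite_subset)
      also have "\<dots> \<le> real (card {(x, y) \<in> metric_edges R F. x \<in> B \<and> y \<notin> B})"
        by (intro of_nat_mono card_bdry_le_edges) (use F that(1) in auto)
      finally show ?thesis .
    qed
    have "F \<noteq> {}" using F by blast
    let ?\<mu> = "pmf_of_set F"
    obtain \<phi> where "\<phi> \<in> hcarrier (l2 ?\<mu> complex_line)" "hnorm (l2 ?\<mu> complex_line) \<phi> = 1"
        "bounded (l2_supp ?\<mu> complex_line \<phi>)" "diameter (l2_supp ?\<mu> complex_line \<phi>) \<le> S"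
        "c * op_norm (l2 ?\<mu> complex_line) (finite_support.lift_op ?\<mu> (walk ^^ n))
          \<le> hnorm (l2 ?\<mu> complex_line) (finite_support.lift_op ?\<mu> (walk ^^ n) \<phi>)"
      using onl_S[OF nonzero_separable_complex_line funpow_walk_finite_prop[OF \<open>F \<noteq> {}\<close>]] by blast
    from localised_sqnorm_lower_bound[OF \<open>F \<noteq> {}\<close> less_imp_le[OF c] this]
    obtain g where g: "sqnorm g > 0" "c\<^sup>2 * sqnorm g \<le> sqnorm ((walk ^^ n) g)"
      "\<And>x y. x \<in> F \<Longrightarrow> y \<in> F \<Longrightarrow> g x \<noteq> 0 \<Longrightarrow> g y \<noteq> 0 \<Longrightarrow> dist x y \<le> S"
      by blast
    \<comment> \<open>Expansion makes \<open>g\<close> shrink by \<open>q ^ n\<close>, below the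
      share \<open>c\<^sup>2\<close> that localisation guarantees.\<close>
    have "sqnorm ((walk ^^ n) g) \<le> q ^ n * sqnorm g"
      using \<epsilon> q g(3) expansion by (intro funpow_walk_contracts[where \<epsilon> = \<epsilon> and q = q and n = n and S = S]) auto
    also have "\<dots> < c\<^sup>2 * sqnorm g"
      using n(2) g(1) by simp
    finally show False using g(2) by simp
  qed
qed

end
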